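(* Consider the distributed non-stochastic expert problem in the coordinator prediction model with $n=2$ experts and time horizon $T$. Consider any algorithm with an arbitrary communication protocol satisfying: (i) whenever a site communicates with the coordinator, the site reports its local cumulative payoff vector; (ii) when the coordinator makes a decision, it executes $\mathsf{FPL}(\sqrt T)$ (follow the perturbed leader with noise $\sqrt T$) using the latest cumulative payoff vector. If such an algorithm achieves expected regret $O(\sqrt T)$ against every oblivious adversary, then for every constant $\epsilon>0$ it must use $\Omega(T^{1-\epsilon})$ communication against an oblivious adversary.
   Context: Coordinator prediction model. A distributed system consists of one coordinator node connected to $k\ge1$ site nodes; sites communicate with each other only via the coordinator. At each time step $t=1,\dots,T$ the coordinator receives a query and must pick an expert $a^t\in[n]$; at the end of the round one site $s^t$ observes the payoff vector $\mathbf p^t\in[0,1]^n$, and the system receives payoff $\mathbf p^t[a^t]$. An oblivious adversary chooses the sequences $(\mathbf p^t)$ and $(s^t)$ in advance, knowing the description of the algorithm but not seeing its actions or random bits. The local cumulative payoff vector of a site is the sum of all payoff vectors that site has observed so far. The latest cumulative payoff vector at the coordinator is the sum over sites of the local cumulative payoff vectors most recently reported. The times of communication may be decided arbitrarily, e.g. depending on the payoff vectors observed and on random bits. Executing $\mathsf{FPL}(\eta)$ at a time step with cumulative payoff vector $\mathbf P\in\mathbb R^2$ means: draw a fresh $r$ uniformly from $[0,\eta]^2$ and choose expert $1$ if $(\mathbf P+r)_1>(\mathbf P+r)_2$ and expert $2$ otherwise. Expected regret is $\mathbb E\big[\max_{a\in[n]}\sum_{t=1}^T\mathbf p^t[a]-\sum_{t=1}^T\mathbf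 p^t[a^t]\big]$. Communication is the number of messages sent between nodes. Asymptotics are as $T\to\infty$. *)

theory Defs
  imports "HOL-Probability.Probability"
begin

text \<open>
  Experts are the elements \<open>1\<close> and \<open>2\<close> of the index type \<open>2\<close>, so payoff vectors live in
  \<open>real ^ 2\<close>. Sites are \<open>0, \<dots>, k - 1\<close> and rounds are \<open>1, \<dots>, T\<close>. An oblivious adversary is a
  pair \<open>(p, s)\<close>: the payoff vector \<open>p t\<close> of round \<open>t\<close> is observed by site \<open>s t\<close>.
\<close>

definition adversary :: "nat \<Rightarrow> nat \<Rightarrow> (nat \<Rightarrow> real ^ 2) \<Rightarrow> (nat \<Rightarrow> nat) \<Rightarrow> bool" where
  "adversary k T p s \<longleftrightarrow>
     (\<forall>t\<in>{1..T}. s t < k \<and> (\<forall>a. 0 \<le> p t $ a \<and> p t $ a \<le> 1))"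

definition fpl_noise :: "real \<Rightarrow> (real ^ 2) measure" where
  "fpl_noise \<eta> = uniform_measure lborel (cbox 0 (\<chi> i. \<eta>))"

definition fpl_choice :: "real ^ 2 \<Rightarrow> real ^ 2 \<Rightarrow> 2" where
  "fpl_choice P r = (if (P + r) $ 1 > (P + r) $ 2 then 1 else 2)"

text \<open>
  A communication protocol. Communication phase \<open>t\<close> (for \<open>0 \<le> t \<le> T\<close>) lies after the observation
  of round \<open>t\<close> and before the decision of round \<open>t + 1\<close>. The numbers of messages that site \<open>j\<close>
  sends to (\<open>up\<close>) and receives from (\<open>down\<close>) the coordinator in phase \<open>t\<close> may depend on all random
  bits of the protocol (an element of the arbitrary probability space \<open>seed\<close>), on the list of the
  first \<open>t\<close> pairs (observing site, payoff vector), and on the list of the first \<open>t\<close> FPL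
  perturbations (hence also on past actions). Future payoffs and perturbations are not arguments, so
  protocols are non-anticipating by typing. Dependence on the joint history of all nodes subsumes
  every exchange of information through messages of arbitrary content.
\<close>

record 'w protocol =
  seed :: "'w measure"
  up :: "'w \<Rightarrow> (nat \<times> (real ^ 2)) list \<Rightarrow> (real ^ 2) list \<Rightarrow> nat \<Rightarrow> nat"
  down :: "'w \<Rightarrow> (nat \<times> (real ^ 2)) list \<Rightarrow> (real ^ 2) list \<Rightarrow> nat \<Rightarrow> nat"

definition observations :: "(nat \<Rightarrow> real ^ 2) \<Rightarrow> (nat \<Rightarrow> nat) \<Rightarrow> nat \<Rightarrow> (nat \<times> (real ^ 2)) list" where
  "observations p s t = map (\<lambda>i. (s i, p i)) [1..<Suc t]"

definition ups ::
  "'w protocol \<Rightarrow> (nat \<Rightarrow> real ^ 2) \<Rightarrow> (nat \<Rightarrow> nat) \<Rightarrow> 'w \<times> (nat \<Rightarrow> real ^ 2) \<Rightarrow> nat \<Rightarrow> nat \<Rightarrow> nat" where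
  "ups A p s x t j = up A (fst x) (observations p s t) (map (snd x) [1..<Suc t]) j"

definition downs ::
  "'w protocol \<Rightarrow> (nat \<Rightarrow> real ^ 2) \<Rightarrow> (nat \<Rightarrow> nat) \<Rightarrow> 'w \<times> (nat \<Rightarrow> real ^ 2) \<Rightarrow> nat \<Rightarrow> nat \<Rightarrow> nat" where
  "downs A p s x t j = down A (fst x) (observations p s t) (map (snd x) [1..<Suc t]) j"

text \<open>
  The sample space of a run: the random bits of the protocol together with an independent sequence
  of fresh perturbations, one per round, for \<open>FPL(sqrt T)\<close>.
\<close>

definition run_space :: "nat \<Rightarrow> 'w protocol \<Rightarrow> ('w \<times> (nat \<Rightarrow> real ^ 2)) measure" where
  "run_space T A = seed A \<Otimes>\<^sub>M (\<Pi>\<^sub>M t\<in>{1..T}. fpl_noise (sqrt (real T)))"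

definition valid_protocol :: "nat \<Rightarrow> nat \<Rightarrow> 'w protocol \<Rightarrow> bool" where
  "valid_protocol k T A \<longleftrightarrow>
     prob_space (seed A) \<and>
     (\<forall>p s. adversary k T p s \<longrightarrow>
        (\<forall>t\<le>T. \<forall>j<k.
           (\<lambda>x. ups A p s x t j) \<in> measurable (run_space T A) (count_space UNIV) \<and>
           (\<lambda>x. downs A p s x t j) \<in> measurable (run_space T A) (count_space UNIV)))"

definition local_payoff :: "(nat \<Rightarrow> real ^ 2) \<Rightarrow> (nat \<Rightarrow> nat) \<Rightarrow> nat \<Rightarrow> nat \<Rightarrow> real ^ 2" where
  "local_payoff p s t j = (\<Sum>i | i \<in> {1..t} \<and> s i = j. p i)"

text \<open>
  The vector most recently reported by site \<open>j\<close> once phase \<open>t\<close> is over; it is \<open>0\<close> as long as the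
  site has not reported. (A report in phase \<open>0\<close> would also be \<open>0\<close>.)
\<close>

primrec reported ::
  "'w protocol \<Rightarrow> (nat \<Rightarrow> real ^ 2) \<Rightarrow> (nat \<Rightarrow> nat) \<Rightarrow> 'w \<times> (nat \<Rightarrow> real ^ 2) \<Rightarrow> nat \<Rightarrow> nat \<Rightarrow> real ^ 2"
where
  "reported A p s x j 0 = 0"
| "reported A p s x j (Suc t) =
     (if ups A p s x (Suc t) j > 0 then local_payoff p s (Suc t) j else reported A p s x j t)"

definition latest_cumulative ::
  "nat \<Rightarrow> 'w protocol \<Rightarrow> (nat \<Rightarrow> real ^ 2) \<Rightarrow> (nat \<Rightarrow> nat) \<Rightarrow> 'w \<times> (nat \<Rightarrow> real ^ 2) \<Rightarrow> nat \<Rightarrow> real ^ 2"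
where
  "latest_cumulative k A p s x t = (\<Sum>j<k. reported A p s x j t)"

definition action ::
  "nat \<Rightarrow> 'w protocol \<Rightarrow> (nat \<Rightarrow> real ^ 2) \<Rightarrow> (nat \<Rightarrow> nat) \<Rightarrow> 'w \<times> (nat \<Rightarrow> real ^ 2) \<Rightarrow> nat \<Rightarrow> 2" where
  "action k A p s x t = fpl_choice (latest_cumulative k A p s x (t - 1)) (snd x t)"

definition expected_regret ::
  "nat \<Rightarrow> nat \<Rightarrow> 'w protocol \<Rightarrow> (nat \<Rightarrow> real ^ 2) \<Rightarrow> (nat \<Rightarrow> nat) \<Rightarrow> real" where
  "expected_regret k T A p s =
     (\<integral>x. (MAX a. \<Sum>t=1..T. p t $ a) - (\<Sum>t=1..T. p t $ action k A p s x t) \<partial>run_space T A)"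

definition expected_communication ::
  "nat \<Rightarrow> nat \<Rightarrow> 'w protocol \<Rightarrow> (nat \<Rightarrow> real ^ 2) \<Rightarrow> (nat \<Rightarrow> nat) \<Rightarrow> ennreal" where
  "expected_communication k T A p s =
     (\<integral>\<^sup>+x. of_nat (\<Sum>t\<le>T. \<Sum>j<k. ups A p s x t j + downs A p s x t j) \<partial>run_space T A)"

end

theory Submission
  imports Defs
begin

text \<open>
  All payoffs go to one site. The horizon is cut into blocks of a constant length \<open>l\<close>, and in each
  block an independent fair coin decides which expert is paid throughout the block. The best expert
  then gains about \<open>sqrt (l T)\<close> over the mean, so the algorithm must itself gain almost that much.
  A decision based on the report held at the start of the block gains nothing on average, hence all
  gain comes from reports sent within the block; the Lipschitz bound for \<open>FPL(sqrt T)\<close> limits that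
  gain, per round, to \<open>1 / sqrt T\<close> times the change of the reported difference. That change is at
  most \<open>l (\<bar>q\<bar> + 2)\<close>, where \<open>q\<close> is the displacement, in blocks, of the coin walk since the last
  block with a report. By orthogonality of martingale increments the squares of these displacements
  add up to at most the number of blocks, so by AM-GM \<open>N\<close> reports gain
  \<open>O(l^3 N / sqrt T + sqrt T)\<close>. For \<open>l\<close> large in terms of the regret constant this forces
  \<open>N = \<Omega>(T / l^3)\<close>.
\<close>

subsection \<open>Coin walks\<close>

definition coin :: "nat set \<Rightarrow> nat \<Rightarrow> real" where
  "coin S b = (if b \<in> S then 1 else -1)"

definition walk :: "nat set \<Rightarrow> nat \<Rightarrow> real" where
  "walk S m = (\<Sum>b<m. coin S b)"

text \<open>A coin sequence is encoded as the set of blocks with value 1, and sums over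
  \<open>Pow {..<M}\<close> stand for expectations. In this encoding
  \<open>past_determined b\<close> is measurability with respect to the first \<open>b\<close>
  coins.\<close>

definition past_determined :: "nat \<Rightarrow> (nat set \<Rightarrow> 'a) \<Rightarrow> bool" where
  "past_determined b Z \<longleftrightarrow> (\<forall>S S'. S \<inter> {..<b} = S' \<inter> {..<b} \<longrightarrow> Z S = Z S')"

lemma past_determinedD:
  "past_determined b Z \<Longrightarrow> S \<inter> {..<b} = S' \<inter> {..<b} \<Longrightarrow> Z S = Z S'"
  unfolding past_determined_def by blast

lemma coin_square [simp]: "(coin S b)\<^sup>2 = 1"
  and abs_coin [simp]: "\<bar>coin S b\<bar> = 1"
  by (auto simp: coin_def)

lemma walk_0 [simp]: "walk S 0 = 0"
  and walk_Suc: "walk S (Suc m) = walk S m + coin S m"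
  by (simp_all add: walk_def)

lemma past_determined_walk: "past_determined b (\<lambda>S. walk S b)"
  unfolding past_determined_def walk_def coin_def by (intro allI impI sum.cong) auto

lemma past_determined_compose:
  "past_determined b Z \<Longrightarrow> past_determined b (\<lambda>S. f (Z S))"
  unfolding past_determined_def by metis

text \<open>Flipping coin \<open>b\<close> is an involution of \<open>Pow {..<M}\<close> that
  negates \<open>coin S b\<close> and fixes \<open>Z S\<close>. This is the martingale difference
  property of the coins.\<close>

lemma sum_coin_past_determined:
  assumes "b < M" and "past_determined b Z"
  shows "(\<Sum>S\<in>Pow {..<M}. coin S b * Z S) = 0"
proof -
  define flip where "flip S = (if b \<in> S then S - {b} else insert b S)" for S
  have bij: "bij_betw flip (Pow {..<M}) (Pow {..<M})"
    by (rule bij_betwI[where g = flip]) (use assms(1) in \<open>auto simp: flip_def split: if_splits\<close>)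
  have "coin (flip S) b * Z (flip S) = - (coin S b * Z S)" for S
  proof -
    have "flip S \<inter> {..<b} = S \<inter> {..<b}"
      by (auto simp: flip_def)
    then have "Z (flip S) = Z S"
      by (rule past_determinedD[OF assms(2)])
    then show ?thesis by (auto simp: coin_def flip_def)
  qed
  then have "(\<Sum>S\<in>Pow {..<M}. coin S b * Z S) = - (\<Sum>S\<in>Pow {..<M}. coin S b * Z S)"
    using sum.reindex_bij_betw[OF bij, of "\<lambda>S. coin S b * Z S"] by (simp add: sum_negf)
  then show ?thesis by simp
qed

lemma sum_walk_square:
  "m \<le> M \<Longrightarrow> (\<Sum>S\<in>Pow {..<M}. (walk S m)\<^sup>2) = 2 ^ M * real m"
proof (induction m)
  case (Suc m)
  have "(walk S (Suc m))\<^sup>2 = (walk S m)\<^sup>2 + 2 * (coin S m * walk S m) + 1" for S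
    by (simp add: walk_Suc power2_sum mult.commute)
  then show ?case
    using Suc sum_coin_past_determined[OF _ past_determined_walk, of m M]
    by (simp add: sum.distrib card_Pow flip: sum_distrib_left) (simp add: algebra_simps)
qed simp

text \<open>Terms odd in the new coin average out, so a step adds 6 m + 1 on average, which is below
  the increment 6 m + 3 of 3 m^2.\<close>

lemma sum_walk_fourth:
  "m \<le> M \<Longrightarrow> (\<Sum>S\<in>Pow {..<M}. walk S m ^ 4) \<le> 2 ^ M * (3 * (real m)\<^sup>2)"
proof (induction m)
  case (Suc m)
  have *: "walk S (Suc m) ^ 4 = walk S m ^ 4 + 4 * (coin S m * walk S m ^ 3)
      + 6 * (walk S m)\<^sup>2 + 4 * (coin S m * walk S m) + 1" for S
    by (auto simp: walk_Suc coin_def power4_eq_xxxx power3_eq_cube power2_eq_square algebra_simps)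
  have "(\<Sum>S\<in>Pow {..<M}. walk S (Suc m) ^ 4) =
     (\<Sum>S\<in>Pow {..<M}. walk S m ^ 4) + 6 * (2 ^ M * real m) + 2 ^ M"
    using Suc.prems sum_coin_past_determined[OF _ past_determined_walk, of m M]
      sum_coin_past_determined[of m M, OF _ past_determined_compose[OF past_determined_walk, where f = "\<lambda>z. z ^ 3"]]
      sum_walk_square[of m M]
    by (simp add: * sum.distrib card_Pow flip: sum_distrib_left)
  also have "\<dots> \<le> 2 ^ M * (3 * (real m)\<^sup>2) + 6 * (2 ^ M * real m) + 2 ^ M"
    using Suc by simp
  also have "\<dots> = 2 ^ M * (3 * (real m)\<^sup>2 + 6 * real m + 1)"
    by (simp add: algebra_simps)
  also have "\<dots> \<le> 2 ^ M * (3 * (real (Suc m))\<^sup>2)"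
    by (intro mult_left_mono) (simp_all add: power2_eq_square algebra_simps)
  finally show ?case .
qed simp

text \<open>A Khintchine inequality from the second and fourth moments: the pointwise bound
  \<open>ineq\<close> is averaged at y = walk / a. For a^2 = 3 M / 2 the quadratic term gives 2/3
  and the quartic term takes away at most 1/3.\<close>

lemma sum_abs_walk_ge:
  "2 ^ M * (sqrt (3 / 2 * real M) / 3) \<le> (\<Sum>S\<in>Pow {..<M}. \<bar>walk S M\<bar>)"
proof (cases "M = 0")
  case False
  define a where "a = sqrt (3 / 2 * real M)"
  have a: "a > 0" "a\<^sup>2 = 3 / 2 * real M"
    using False by (simp_all add: a_def)
  have ineq: "y\<^sup>2 - y ^ 4 / 4 \<le> \<bar>y\<bar>" for y :: real
  proof -
    define z where "z = \<bar>y\<bar>"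
    have "z \<ge> 0" by (simp add: z_def)
    have "z - z ^ 3 / 4 \<le> 1"
    proof -
      \<comment> \<open>On z \<ge> 0 the cube lies above its tangent at 6/5, a point near the
        maximiser 2 / sqrt 3 of z - z^3 / 4. The slope 108/25 is just above the 4 that absorbs the
        linear term.\<close>
      have "0 \<le> (z + 12 / 5) * (z - 6 / 5)\<^sup>2" using \<open>z \<ge> 0\<close> by simp
      also have "\<dots> = z ^ 3 - 108 / 25 * z + 432 / 125"
        by (simp add: power2_eq_square power3_eq_cube field_simps)
      finally show ?thesis using \<open>z \<ge> 0\<close> by simp
    qed
    then have "z * (z - z ^ 3 / 4) \<le> z * 1"
      using \<open>z \<ge> 0\<close> by (intro mult_left_mono)
    then have "z\<^sup>2 - z ^ 4 / 4 \<le> z"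
      by (simp add: power2_eq_square power3_eq_cube power4_eq_xxxx algebra_simps)
    then show ?thesis by (simp add: z_def)
  qed
  have "2 ^ M * (a / 3) = a * (2 ^ M * real M / a\<^sup>2 - 2 ^ M * (3 * (real M)\<^sup>2) / (4 * (a\<^sup>2)\<^sup>2))"
    using False unfolding a(2) by (simp add: field_simps power2_eq_square)
  also have "\<dots> \<le> a * ((\<Sum>S\<in>Pow {..<M}. (walk S M)\<^sup>2) / a\<^sup>2 -
      (\<Sum>S\<in>Pow {..<M}. walk S M ^ 4) / (4 * (a\<^sup>2)\<^sup>2))"
    using a(1) sum_walk_square[of M M] sum_walk_fourth[of M M]
    by (intro mult_left_mono diff_mono divide_right_mono) auto
  also have "\<dots> = a * (\<Sum>S\<in>Pow {..<M}. (walk S M / a)\<^sup>2 - (walk S M / a) ^ 4 / 4)"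
    by (simp add: sum_subtractf sum_divide_distrib power_divide mult.commute flip: power_mult)
  also have "\<dots> \<le> a * (\<Sum>S\<in>Pow {..<M}. \<bar>walk S M / a\<bar>)"
    using a(1) by (intro mult_left_mono sum_mono ineq) auto
  also have "\<dots> = (\<Sum>S\<in>Pow {..<M}. \<bar>walk S M\<bar>)"
    using a(1) by (simp add: sum_distrib_left)
  finally show ?thesis by (simp add: a_def)
qed simp

text \<open>
  The displacement of the walk since the end of the last block \<open>b\<close> with \<open>R b\<close>. Contact in block \<open>b\<close>
  may depend on the coin of block \<open>b\<close> itself, hence the \<open>Suc b\<close> in \<open>sum_stale_square_le\<close>.
\<close>

primrec stale :: "(nat \<Rightarrow> bool) \<Rightarrow> nat set \<Rightarrow> nat \<Rightarrow> real" where
  "stale R S 0 = 0"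
| "stale R S (Suc b) = (if R b then 0 else stale R S b + coin S b)"

lemma stale_cong:
  assumes "\<And>i. i < b \<Longrightarrow> R i = R' i" and "S \<inter> {..<b} = S' \<inter> {..<b}"
  shows "stale R S b = stale R' S' b"
  using assms
proof (induction b)
  case (Suc b)
  have "i \<in> S \<longleftrightarrow> i \<in> S'" if "i < Suc b" for i
    using Suc.prems(2) that by (auto simp: set_eq_iff)
  then have "S \<inter> {..<b} = S' \<inter> {..<b}" "coin S b = coin S' b"
    by (auto simp: coin_def)
  moreover from this have "stale R S b = stale R' S' b"
    by (intro Suc.IH Suc.prems(1)) auto
  moreover have "R b = R' b"
    by (rule Suc.prems(1)) simp
  ultimately show ?case by (simp only: stale.simps)
qed simp

lemma sum_stale_square_le:
  assumes "\<And>b. past_determined (Suc b) (\<lambda>S. R S b)"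
  shows "(\<Sum>S\<in>Pow {..<M}. \<Sum>b<M. of_bool (R S b) * (stale (R S) S b + coin S b)\<^sup>2) \<le> 2 ^ M * real M"
proof -
  let ?q = "\<lambda>S b. stale (R S) S b"
  have past: "past_determined b (\<lambda>S. ?q S b)" for b
    unfolding past_determined_def
  proof (intro allI impI)
    fix S S' :: "nat set"
    assume eq: "S \<inter> {..<b} = S' \<inter> {..<b}"
    have "R S i = R S' i" if "i < b" for i
    proof -
      have "U \<inter> {..<Suc i} = U \<inter> {..<b} \<inter> {..<Suc i}" for U
        using that by auto
      then show ?thesis
        by (intro past_determinedD[OF assms]) (metis eq)
    qed
    then show "?q S b = ?q S' b" using eq by (rule stale_cong)
  qed
  \<comment> \<open>Squares settled at past contacts plus the current square. With or without
    contact in block \<open>m\<close>, the square of \<open>?q S m + coin S m\<close> is counted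
    exactly once, so the block adds a cross term of mean zero and the constant 1.\<close>
  have energy: "(\<Sum>S\<in>Pow {..<M}. (\<Sum>b<m. of_bool (R S b) * (?q S b + coin S b)\<^sup>2) + (?q S m)\<^sup>2)
      = 2 ^ M * real m" if "m \<le> M" for m
    using that
  proof (induction m)
    case (Suc m)
    have "(\<Sum>b<Suc m. of_bool (R S b) * (?q S b + coin S b)\<^sup>2) + (?q S (Suc m))\<^sup>2 =
       (\<Sum>b<m. of_bool (R S b) * (?q S b + coin S b)\<^sup>2) + (?q S m)\<^sup>2 + 2 * (coin S m * ?q S m) + 1" for S
      by (cases "R S m") (simp_all add: power2_sum)
    then have "(\<Sum>S\<in>Pow {..<M}. (\<Sum>b<Suc m. of_bool (R S b) * (?q S b + coin S b)\<^sup>2) + (?q S (Suc m))\<^sup>2)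
      = (\<Sum>S\<in>Pow {..<M}. (\<Sum>b<m. of_bool (R S b) * (?q S b + coin S b)\<^sup>2) + (?q S m)\<^sup>2)
        + 2 * (\<Sum>S\<in>Pow {..<M}. coin S m * ?q S m) + 2 ^ M"
      by (simp only: sum.distrib sum_distrib_left) (simp add: card_Pow)
    then show ?case
      using Suc sum_coin_past_determined[OF _ past, of m M] by (simp add: algebra_simps)
  qed simp
  show ?thesis
    by (rule order_trans[OF sum_mono eq_refl[OF energy[of M]]]) auto
qed

subsection \<open>The perturbation\<close>

text \<open>The shear sending r to (r_1 - r_2, r_2) has determinant 1 and maps the set into a
  rectangle with sides \<open>d\<close> and \<open>\<eta>\<close>.\<close>

lemma measure_square_strip_le:
  fixes \<eta> c d :: real
  assumes "\<eta> \<ge> 0" "d \<ge> 0"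
  shows "measure lborel (cbox 0 (\<chi> i. \<eta>) \<inter> {r :: real ^ 2. c \<le> r $ 1 - r $ 2 \<and> r $ 1 - r $ 2 \<le> c + d}) \<le> d * \<eta>"
    (is "measure _ ?S \<le> _")
proof -
  define f :: "real ^ 2 \<Rightarrow> real ^ 2" where "f r = (\<chi> i. if i = 1 then r $ 1 - r $ 2 else r $ 2)" for r
  have lin: "linear f"
    by (intro linearI) (simp_all add: f_def vec_eq_iff algebra_simps)
  have "det (matrix f) = 1"
    by (simp add: det_2 matrix_def f_def axis_def)
  have strip: "closed {r :: real ^ 2. c \<le> r $ 1 - r $ 2 \<and> r $ 1 - r $ 2 \<le> c + d}"
    by (intro closed_Collect_conj closed_Collect_le continuous_intros)
  then have "compact ?S"
    by (intro compact_Int_closed compact_cbox)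
  then have S: "?S \<in> lmeasurable" "?S \<in> sets borel"
    by (auto intro: lmeasurable_compact borel_compact)
  have "f ` ?S \<subseteq> cbox (\<chi> i. if i = 1 then c else 0) (\<chi> i. if i = 1 then c + d else \<eta>)"
    by (auto simp: f_def mem_box_cart)
  then have "measure lebesgue (f ` ?S) \<le>
      measure lebesgue (cbox (\<chi> i. if i = 1 then c else 0) (\<chi> i. if i = 1 then c + d else \<eta>) :: (real ^ 2) set)"
    using measurable_linear_image[OF lin S(1)] by (intro measure_mono_fmeasurable) auto
  also have "\<dots> = d * \<eta>"
    using assms by (subst measure_completion) (auto simp: content_cbox_if_cart interval_eq_empty_cart UNIV_2 split: if_splits)
  finally show ?thesis
    using measure_linear_image[OF lin S(1)] \<open>det (matrix f) = 1\<close> S(2) by simp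
qed

lemma emeasure_lborel_square:
  "\<eta> \<ge> 0 \<Longrightarrow> emeasure lborel (cbox 0 (\<chi> i. \<eta>) :: (real ^ 2) set) = ennreal (\<eta> * \<eta>)"
  using emeasure_lborel_cbox_finite[of "0 :: real ^ 2" "\<chi> i. \<eta>"]
  by (subst emeasure_eq_ennreal_measure)
     (auto simp: content_cbox_if_cart interval_eq_empty_cart UNIV_2 not_less)

lemma prob_space_fpl_noise: "\<eta> > 0 \<Longrightarrow> prob_space (fpl_noise \<eta>)"
  unfolding fpl_noise_def
  by (intro prob_space_uniform_measure) (simp_all add: emeasure_lborel_square)

lemma sets_fpl_noise [measurable_cong, simp]: "sets (fpl_noise \<eta>) = sets borel"
  and space_fpl_noise [simp]: "space (fpl_noise \<eta>) = UNIV"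
  by (simp_all add: fpl_noise_def)

text \<open>The choice depends on the report only through the difference \<open>u\<close> of its
  entries. The value 1 stands for expert 1 and -1, also at a tie, for expert 2, so that multiplying
  by a coin measures the gain.\<close>

definition fpl_sign :: "real \<Rightarrow> real ^ 2 \<Rightarrow> real" where
  "fpl_sign u r = (if u + (r $ 1 - r $ 2) > 0 then 1 else -1)"

lemma abs_fpl_sign [simp]: "\<bar>fpl_sign u r\<bar> = 1"
  by (simp add: fpl_sign_def)

lemma measurable_fpl_sign [measurable]:
  assumes [measurable]: "f \<in> borel_measurable M" "g \<in> borel_measurable M"
  shows "(\<lambda>x. fpl_sign (f x) (g x)) \<in> borel_measurable M"
proof -
  have [measurable]: "(\<lambda>r :: real ^ 2. r $ i) \<in> borel_measurable borel" for i
    by (intro borel_measurable_continuous_onI continuous_intros)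
  show ?thesis unfolding fpl_sign_def by measurable
qed

text \<open>The two signs differ, by 2, only if the noise difference lies between -max u v and -min
  u v. This strip has width \<bar>u - v\<bar> and takes at most the fraction \<bar>u - v\<bar> /
  \<eta> of the square.\<close>

lemma nn_integral_fpl_sign_diff_le:
  assumes "\<eta> > 0"
  shows "(\<integral>\<^sup>+ r. ennreal \<bar>fpl_sign u r - fpl_sign v r\<bar> \<partial>fpl_noise \<eta>) \<le> ennreal (2 / \<eta> * \<bar>u - v\<bar>)"
proof -
  define c where "c = - max u v"
  let ?S = "{r :: real ^ 2. c \<le> r $ 1 - r $ 2 \<and> r $ 1 - r $ 2 \<le> c + \<bar>u - v\<bar>}"
  have S [measurable]: "?S \<in> sets borel"
    by measurable
  have fin: "emeasure lborel (cbox 0 (\<chi> i. \<eta>) \<inter> ?S) < \<infinity>"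
    by (intro le_less_trans[OF emeasure_mono emeasure_lborel_cbox_finite]) auto
  have "(\<integral>\<^sup>+ r. ennreal \<bar>fpl_sign u r - fpl_sign v r\<bar> \<partial>fpl_noise \<eta>)
      \<le> (\<integral>\<^sup>+ r. 2 * indicator ?S r \<partial>fpl_noise \<eta>)"
    by (intro nn_integral_mono) (auto simp: fpl_sign_def c_def indicator_def max_def ennreal_numeral[symmetric] simp del: ennreal_numeral)
  also have "\<dots> = 2 * emeasure (fpl_noise \<eta>) ?S"
    by (subst nn_integral_cmult_indicator) auto
  also have "\<dots> = 2 * (ennreal (measure lborel (cbox 0 (\<chi> i. \<eta>) \<inter> ?S)) / ennreal (\<eta> * \<eta>))"
    using assms fin unfolding fpl_noise_def
    by (subst emeasure_uniform_measure)
       (auto simp: emeasure_lborel_square emeasure_eq_ennreal_measure[OF less_imp_neq[OF fin, unfolded infinity_ennreal_def]])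
  also have "\<dots> \<le> 2 * (ennreal (\<bar>u - v\<bar> * \<eta>) / ennreal (\<eta> * \<eta>))"
    using assms by (intro mult_left_mono divide_right_mono_ennreal ennreal_leI measure_square_strip_le) auto
  also have "\<dots> = ennreal 2 * ennreal (\<bar>u - v\<bar> * \<eta> / (\<eta> * \<eta>))"
    using assms by (subst divide_ennreal) auto
  also have "\<dots> = ennreal (2 / \<eta> * \<bar>u - v\<bar>)"
    using assms by (subst ennreal_mult'[symmetric]) (auto simp: field_simps)
  finally show ?thesis .
qed

text \<open>By Fubini coordinate \<open>t\<close> is integrated first while all other randomness is
  frozen. This isolates the fresh perturbation of a single round.\<close>

lemma nn_integral_PiM_resample_le:
  assumes "finite I" "t \<in> I" "\<And>i. prob_space (M i)"
    and [measurable]: "f \<in> borel_measurable (N \<Otimes>\<^sub>M Pi\<^sub>M I M)" "g \<in> borel_measurable (N \<Otimes>\<^sub>M Pi\<^sub>M I M)"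
    and le: "\<And>w r. (\<integral>\<^sup>+ y. f (w, r(t := y)) \<partial>M t) \<le> (\<integral>\<^sup>+ y. g (w, r(t := y)) \<partial>M t)"
  shows "(\<integral>\<^sup>+ x. f x \<partial>(N \<Otimes>\<^sub>M Pi\<^sub>M I M)) \<le> (\<integral>\<^sup>+ x. g x \<partial>(N \<Otimes>\<^sub>M Pi\<^sub>M I M))"
proof -
  interpret product_prob_space M
    using assms(3) by (rule product_prob_spaceI)
  interpret P: prob_space "Pi\<^sub>M I M"
    using assms(3) by (rule prob_space_PiM)
  have I: "I = insert t (I - {t})" using assms(2) by auto
  have *: "(\<integral>\<^sup>+ r. h (w, r) \<partial>Pi\<^sub>M I M) = (\<integral>\<^sup>+ r. \<integral>\<^sup>+ y. h (w, r(t := y)) \<partial>M t \<partial>Pi\<^sub>M (I - {t}) M)"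
    if "h \<in> borel_measurable (N \<Otimes>\<^sub>M Pi\<^sub>M I M)" "w \<in> space N" for h w
    by (subst I, rule product_nn_integral_insert)
       (use assms(1) measurable_Pair2[OF that] I in auto)
  have "(\<integral>\<^sup>+ w. \<integral>\<^sup>+ r. f (w, r) \<partial>Pi\<^sub>M I M \<partial>N) \<le> (\<integral>\<^sup>+ w. \<integral>\<^sup>+ r. g (w, r) \<partial>Pi\<^sub>M I M \<partial>N)"
    by (rule nn_integral_mono) (simp add: *[OF assms(4)] *[OF assms(5)] nn_integral_mono le)
  then show ?thesis
    by (simp add: P.nn_integral_fst)
qed

subsection \<open>The block adversary\<close>

text \<open>Block \<open>b\<close> consists of the rounds \<open>b * l + 1\<close> to
  \<open>Suc b * l\<close>, hence the shift \<open>t - 1\<close>. Left-over rounds after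
  \<open>M * l\<close> pay nothing to either expert and so do not affect the regret.\<close>

definition block_payoff :: "nat \<Rightarrow> nat \<Rightarrow> nat set \<Rightarrow> nat \<Rightarrow> real ^ 2" where
  "block_payoff l M S t =
     (if 1 \<le> t \<and> t \<le> M * l then if (t - 1) div l \<in> S then axis 1 1 else axis 2 1 else 0)"

lemma ups_cong:
  assumes "\<And>i. i \<in> {1..t} \<Longrightarrow> p i = p' i" "fst x = fst x'"
    "\<And>i. i \<in> {1..t} \<Longrightarrow> snd x i = snd x' i"
  shows "ups A p s x t j = ups A p' s x' t j"
proof -
  have "observations p s t = observations p' s t"
    unfolding observations_def by (intro map_cong refl) (use assms(1) in auto)
  moreover have "map (snd x) [1..<Suc t] = map (snd x') [1..<Suc t]"
    by (intro map_cong refl assms(3)) auto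
  ultimately show ?thesis unfolding ups_def by (simp only: assms(2))
qed

lemma reported_cong:
  assumes "\<And>i. i \<in> {1..t} \<Longrightarrow> p i = p' i" "fst x = fst x'"
    "\<And>i. i \<in> {1..t} \<Longrightarrow> snd x i = snd x' i"
  shows "reported A p s x j t = reported A p' s x' j t"
  using assms
proof (induction t)
  case (Suc t)
  have "ups A p s x (Suc t) j = ups A p' s x' (Suc t) j"
    by (intro ups_cong Suc.prems)
  moreover have "local_payoff p s (Suc t) j = local_payoff p' s (Suc t) j"
    unfolding local_payoff_def by (intro sum.cong) (use Suc.prems(1) in auto)
  moreover have "reported A p s x j t = reported A p' s x' j t"
    by (intro Suc.IH Suc.prems) auto
  ultimately show ?case by simp
qed simp

lemma sum_blocks: "(\<Sum>n<M * l. f (n div l)) = real l * (\<Sum>b<M. f b :: real)"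
proof (cases "l = 0")
  case False
  have "(\<Sum>n<M * l. f (n div l)) = (\<Sum>b<M. \<Sum>n = b * l..<b * l + l. f (n div l))"
    by (rule sum.nat_group[symmetric])
  also have "\<dots> = (\<Sum>b<M. \<Sum>n = b * l..<b * l + l. f b)"
    by (intro sum.cong arg_cong[where f = f] refl div_nat_eqI) (auto simp: algebra_simps)
  finally show ?thesis by (simp add: sum_distrib_left)
qed simp

section \<open>The reported difference along a fixed run\<close>

locale block_run =
  fixes k T l M :: nat and A :: "'w protocol"
  assumes site: "k \<ge> 1" and l_pos: "l \<ge> 1" and T_pos: "T \<ge> 1" and blocks_le: "M * l \<le> T"
    and valid: "valid_protocol k T A"
begin

abbreviation "pay \<equiv> block_payoff l M"
abbreviation "update x S t \<equiv> ups A (pay S) (\<lambda>_. 0) x t 0 > 0"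

definition gap :: "nat set \<Rightarrow> nat \<Rightarrow> real" where
  "gap S t = (\<Sum>i = 1..t. pay S i $ 1 - pay S i $ 2)"

definition est :: "'w \<times> (nat \<Rightarrow> real ^ 2) \<Rightarrow> nat set \<Rightarrow> nat \<Rightarrow> real" where
  "est x S t = latest_cumulative k A (pay S) (\<lambda>_. 0) x t $ 1 - latest_cumulative k A (pay S) (\<lambda>_. 0) x t $ 2"

text \<open>A report in phase \<open>Suc b * l\<close> is counted for block \<open>b\<close>
  although it first affects a decision of the next block. Phase 0 lies in no block; a report there
  would be 0.\<close>

definition contact :: "'w \<times> (nat \<Rightarrow> real ^ 2) \<Rightarrow> nat set \<Rightarrow> nat \<Rightarrow> bool" where
  "contact x S b \<longleftrightarrow> (\<exists>t\<in>{b * l<..Suc b * l}. update x S t)"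

lemma adversary_pay: "adversary k T (pay S) (\<lambda>_. 0)"
  using site by (auto simp: adversary_def block_payoff_def axis_def)

lemma pay_nth:
  "n < M * l \<Longrightarrow> pay S (Suc n) $ a = (1 + (if a = 1 then 1 else - 1) * coin S (n div l)) / 2"
  using exhaust_2[of a] by (auto simp: block_payoff_def coin_def axis_def)

lemma pay_cong: "S \<inter> {..<b} = S' \<inter> {..<b} \<Longrightarrow> i \<le> b * l \<Longrightarrow> pay S i = pay S' i"
proof -
  assume "S \<inter> {..<b} = S' \<inter> {..<b}" "i \<le> b * l"
  moreover have "(i - 1) div l < b" if "1 \<le> i"
    using that \<open>i \<le> b * l\<close> l_pos by (simp add: div_less_iff_less_mult)
  moreover have "c \<in> S \<longleftrightarrow> c \<in> S'" if "c < b" for c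
    using that \<open>S \<inter> {..<b} = S' \<inter> {..<b}\<close> by (auto simp: set_eq_iff)
  ultimately show ?thesis
    unfolding block_payoff_def by (simp cong: conj_cong if_cong)
qed

text \<open>Sites other than 0 observe nothing, so whatever they report is the zero vector.\<close>

lemma latest_cumulative_pay:
  "latest_cumulative k A (pay S) (\<lambda>_. 0) x t = reported A (pay S) (\<lambda>_. 0) x 0 t"
proof -
  have "reported A (pay S) (\<lambda>_. 0) x j t = 0" if "j \<noteq> 0" for j
    using that by (induction t) (simp_all add: local_payoff_def)
  then show ?thesis
    using site unfolding latest_cumulative_def
    by (subst sum.mono_neutral_cong_right[of _ "{0}"]) auto
qed

lemma est_0 [simp]: "est x S 0 = 0"
  by (simp add: est_def latest_cumulative_def)

lemma gap_0 [simp]: "gap S 0 = 0"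
  by (simp add: gap_def)

lemma local_payoff_single_site: "local_payoff p (\<lambda>_. 0) t 0 = sum p {1..t}"
  by (simp add: local_payoff_def atLeastAtMost_def atLeast_def atMost_def Int_def)

lemma est_Suc: "est x S (Suc t) = (if update x S (Suc t) then gap S (Suc t) else est x S t)"
  by (simp add: est_def latest_cumulative_pay gap_def local_payoff_single_site sum_subtractf
      del: sum.cl_ivl_Suc)

lemma gap_block:
  assumes "b < M" "b * l \<le> t" "t \<le> Suc b * l"
  shows "gap S t = gap S (b * l) + (real t - real (b * l)) * coin S b"
  using assms(2,3)
proof (induction t rule: dec_induct)
  case (step t)
  have "t div l = b"
    using step.prems step.hyps by (intro div_nat_eqI) (auto simp: algebra_simps)
  moreover have "t < M * l"
    using step.prems \<open>b < M\<close> mult_le_mono1[of "Suc b" M l] by linarith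
  ultimately have "gap S (Suc t) = gap S t + coin S b"
    by (simp add: gap_def pay_nth field_simps)
  with step show ?case by (simp add: algebra_simps)
qed simp

lemma est_cases:
  assumes "m \<le> t"
  obtains "est x S t = est x S m" "\<And>i. i \<in> {m<..t} \<Longrightarrow> \<not> update x S i"
  | i where "i \<in> {m<..t}" "update x S i" "est x S t = gap S i"
proof -
  have "(est x S t = est x S m \<and> (\<forall>i\<in>{m<..t}. \<not> update x S i)) \<or>
      (\<exists>i\<in>{m<..t}. update x S i \<and> est x S t = gap S i)"
    using assms
  proof (induction t rule: dec_induct)
    case (step t)
    then have "{m<..Suc t} = insert (Suc t) {m<..t}" by auto
    with step show ?case by (auto simp: est_Suc)
  qed simp
  then show ?thesis using that by blast
qed

lemma block_offset:
  assumes "i \<in> {b * l<..t}" "t \<le> Suc b * l"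
  shows "0 \<le> real i - real (b * l)" "real i - real (b * l) \<le> real l"
proof -
  have "b * l \<le> i" "i \<le> b * l + l" using assms by auto
  then show "0 \<le> real i - real (b * l)" "real i - real (b * l) \<le> real l"
    by linarith+
qed

text \<open>\<open>stale\<close> is measured from the end of the last block with contact, while the
  report may come earlier in that block; this costs at most \<open>l\<close>. The error does not
  accumulate: without contact \<open>est\<close> stays constant, and \<open>gap\<close> and
  \<open>l * stale\<close> move by the same amount.\<close>

lemma est_near_anchor:
  "b \<le> M \<Longrightarrow> \<bar>est x S (b * l) - (gap S (b * l) - real l * stale (contact x S) S b)\<bar> \<le> real l"
proof (induction b)
  case (Suc b)
  have gap: "gap S (Suc b * l) = gap S (b * l) + real l * coin S b"
    using gap_block[of b "Suc b * l" S] Suc.prems by (simp add: algebra_simps)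
  have "b * l \<le> Suc b * l" by simp
  then show ?case
  proof (cases rule: est_cases[where x = x and S = S])
    case 1
    then have "\<not> contact x S b" by (auto simp: contact_def)
    with Suc 1 gap show ?thesis by (simp add: algebra_simps)
  next
    case (2 i)
    then have "contact x S b" by (auto simp: contact_def)
    moreover have "gap S i = gap S (b * l) + (real i - real (b * l)) * coin S b"
      using gap_block[of b i S] 2(1) Suc.prems by simp
    moreover have "\<bar>(real i - real (b * l) - real l) * coin S b\<bar> \<le> real l"
      using block_offset[OF 2(1)] by (simp add: abs_mult)
    ultimately show ?thesis
      using gap 2(3) by (simp add: algebra_simps)
  qed
qed simp

text \<open>A majorant for the change of \<open>est\<close> within block \<open>b\<close>. If r is
  the absolute displacement including the block's own coin, the change is at most l r + 3 l, which
  AM-GM splits into a fixed charge per contact and half a square to be summed by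
  \<open>sum_stale_square_le\<close>.\<close>

definition drift :: "'w \<times> (nat \<Rightarrow> real ^ 2) \<Rightarrow> nat set \<Rightarrow> nat \<Rightarrow> real" where
  "drift x S b = of_bool (contact x S b) *
     (real l * (real l / 2 + 3) + (stale (contact x S) S b + coin S b)\<^sup>2 / 2)"

text \<open>A report moves \<open>est\<close> from within \<open>l\<close> of
  \<open>gap S (b * l) - l * q\<close> to within \<open>l\<close> of \<open>gap S (b * l)\<close>,
  hence by at most l \<bar>q\<bar> + 2 l.\<close>

lemma est_change_le:
  assumes "b < M" "b * l \<le> t" "t \<le> Suc b * l"
  shows "\<bar>est x S t - est x S (b * l)\<bar> \<le> drift x S b"
  using assms(2)
proof (cases rule: est_cases[where x = x and S = S])
  case 1
  then show ?thesis by (simp add: drift_def)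
next
  case (2 i)
  define q where "q = stale (contact x S) S b"
  define r where "r = \<bar>q + coin S b\<bar>"
  have "contact x S b"
    using 2(1,2) assms(3) by (auto simp: contact_def)
  have "\<bar>gap S i - gap S (b * l)\<bar> \<le> real l"
  proof -
    have "gap S i = gap S (b * l) + (real i - real (b * l)) * coin S b"
      using gap_block[of b i S] 2(1) assms by simp
    then show ?thesis using block_offset[OF 2(1) assms(3)] by (simp add: abs_mult)
  qed
  moreover have "\<bar>est x S (b * l) - (gap S (b * l) - real l * q)\<bar> \<le> real l"
    using est_near_anchor[of b x S] assms(1) by (simp add: q_def)
  ultimately have "\<bar>est x S t - est x S (b * l)\<bar> \<le> \<bar>real l * q\<bar> + 2 * real l"
    using 2(3) by linarith
  \<comment> \<open>The displacement \<open>q\<close> before the block is replaced by the one after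
    its coin, as counted in \<open>sum_stale_square_le\<close>; this costs one more
    \<open>l\<close>.\<close>
  also have "\<dots> \<le> real l * (r + 1) + 2 * real l"
    using abs_triangle_ineq4[of "q + coin S b" "coin S b"]
    by (simp add: abs_mult r_def mult_left_mono)
  also have "\<dots> \<le> real l * (real l / 2 + 3) + r\<^sup>2 / 2"
    using zero_le_power2[of "r - real l"] by (simp add: power2_diff power2_eq_square algebra_simps)
  finally show ?thesis
    using \<open>contact x S b\<close> by (simp add: drift_def q_def r_def algebra_simps)
qed

lemma ups_past:
  "S \<inter> {..<b} = S' \<inter> {..<b} \<Longrightarrow> t \<le> b * l \<Longrightarrow> ups A (pay S) s x t j = ups A (pay S') s x t j"
  by (intro ups_cong pay_cong[where b = b]) auto

lemma past_determined_est: "past_determined b (\<lambda>S. est x S (b * l))"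
  unfolding past_determined_def est_def latest_cumulative_pay
proof (intro allI impI)
  fix S S' :: "nat set"
  assume "S \<inter> {..<b} = S' \<inter> {..<b}"
  then have "reported A (pay S) (\<lambda>_. 0) x 0 (b * l) = reported A (pay S') (\<lambda>_. 0) x 0 (b * l)"
    by (intro reported_cong pay_cong[where b = b]) auto
  then show "reported A (pay S) (\<lambda>_. 0) x 0 (b * l) $ 1 - reported A (pay S) (\<lambda>_. 0) x 0 (b * l) $ 2 =
      reported A (pay S') (\<lambda>_. 0) x 0 (b * l) $ 1 - reported A (pay S') (\<lambda>_. 0) x 0 (b * l) $ 2"
    by simp
qed

lemma past_determined_contact: "past_determined (Suc b) (\<lambda>S. contact x S b)"
  unfolding past_determined_def contact_def
proof (intro allI impI bex_cong refl)
  fix S S' :: "nat set" and t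
  assume "S \<inter> {..<Suc b} = S' \<inter> {..<Suc b}" "t \<in> {b * l<..Suc b * l}"
  then have "ups A (pay S) (\<lambda>_. 0) x t 0 = ups A (pay S') (\<lambda>_. 0) x t 0"
    by (intro ups_past[where b = "Suc b"]) auto
  then show "update x S t = update x S' t" by simp
qed

text \<open>The run \<open>x\<close> is held fixed while the coins vary, so \<open>contact x\<close>
  is a deterministic rule on coin sequences and \<open>sum_stale_square_le\<close> applies to each
  outcome separately.\<close>

lemma sum_drift_le:
  "(\<Sum>S\<in>Pow {..<M}. \<Sum>b<M. drift x S b) \<le>
     real l * (real l / 2 + 3) * (\<Sum>S\<in>Pow {..<M}. \<Sum>b<M. of_bool (contact x S b)) + 2 ^ M * (real M / 2)"
proof -
  have "drift x S b = real l * (real l / 2 + 3) * of_bool (contact x S b) +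
      (of_bool (contact x S b) * (stale (contact x S) S b + coin S b)\<^sup>2) / 2" for S b
    by (simp add: drift_def)
  then have "(\<Sum>S\<in>Pow {..<M}. \<Sum>b<M. drift x S b) =
      real l * (real l / 2 + 3) * (\<Sum>S\<in>Pow {..<M}. \<Sum>b<M. of_bool (contact x S b)) +
      (\<Sum>S\<in>Pow {..<M}. \<Sum>b<M. of_bool (contact x S b) * (stale (contact x S) S b + coin S b)\<^sup>2) / 2"
    by (simp only: sum.distrib sum_distrib_left sum_divide_distrib)
  with sum_stale_square_le[of "contact x" M, OF past_determined_contact] show ?thesis
    by simp
qed

subsection \<open>Regret against the block adversary\<close>

abbreviation "runs \<equiv> run_space T A"

section \<open>Measurability and integrability over runs\<close>

lemma sqrt_T_pos: "sqrt (real T) > 0"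
  using T_pos by simp

lemma prob_space_runs: "prob_space runs"
proof -
  have "prob_space (seed A)" using valid by (simp add: valid_protocol_def)
  moreover have "prob_space (\<Pi>\<^sub>M t\<in>{1..T}. fpl_noise (sqrt (real T)))"
    by (intro prob_space_PiM prob_space_fpl_noise sqrt_T_pos)
  ultimately show ?thesis
    unfolding run_space_def by (rule prob_space_pair)
qed

sublocale R: prob_space runs
  by (rule prob_space_runs)

lemma measurable_update [measurable]:
  assumes "t \<le> T"
  shows "Measurable.pred runs (\<lambda>x. update x S t)"
proof -
  have [measurable]: "(\<lambda>x. ups A (pay S) (\<lambda>_. 0) x t 0) \<in> measurable runs (count_space UNIV)"
    using valid adversary_pay[of S] site assms by (simp add: valid_protocol_def)
  show ?thesis by measurable
qed

lemma measurable_est [measurable]: "t \<le> T \<Longrightarrow> (\<lambda>x. est x S t) \<in> borel_measurable runs"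
proof (induction t)
  case (Suc t)
  then have [measurable]: "(\<lambda>x. est x S t) \<in> borel_measurable runs"
    "Measurable.pred runs (\<lambda>x. update x S (Suc t))"
    by simp_all
  show ?case unfolding est_Suc by measurable
qed simp

lemma measurable_noise [measurable]:
  "i \<in> {1..T} \<Longrightarrow> (\<lambda>x. snd x i) \<in> borel_measurable runs"
  unfolding run_space_def
  by (rule measurable_compose[OF measurable_snd])
     (use measurable_component_singleton[of i "{1..T}" "\<lambda>_. fpl_noise (sqrt (real T))"] in
       \<open>simp add: measurable_cong_sets[OF refl sets_fpl_noise]\<close>)

lemma block_end_le: "b < M \<Longrightarrow> Suc b * l \<le> T"
  using blocks_le mult_le_mono1[of "Suc b" M l] by linarith

lemma measurable_contact [measurable]:
  assumes "b < M"
  shows "Measurable.pred runs (\<lambda>x. contact x S b)"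
proof -
  have "Measurable.pred runs (\<lambda>x. update x S t)" if "t \<in> {b * l<..Suc b * l}" for t
    using that block_end_le[OF assms] by (intro measurable_update) auto
  then show ?thesis
    unfolding contact_def by (intro pred_intros_finite) auto
qed

lemma measurable_stale:
  "b \<le> M \<Longrightarrow> (\<lambda>x. stale (contact x S) S b) \<in> borel_measurable runs"
proof (induction b)
  case (Suc b)
  then have [measurable]: "(\<lambda>x. stale (contact x S) S b) \<in> borel_measurable runs"
    "Measurable.pred runs (\<lambda>x. contact x S b)"
    by simp_all
  show ?case by simp
qed simp

lemma abs_stale_le: "\<bar>stale Q S b\<bar> \<le> real b"
proof (induction b)
  case (Suc b)
  then show ?case using abs_triangle_ineq[of "stale Q S b" "coin S b"] by simp
qed simp

lemma measurable_drift [measurable]: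
  assumes "b < M"
  shows "(\<lambda>x. drift x S b) \<in> borel_measurable runs"
proof -
  have [measurable]: "(\<lambda>x. stale (contact x S) S b) \<in> borel_measurable runs"
    "Measurable.pred runs (\<lambda>x. contact x S b)"
    using assms by (simp_all add: measurable_stale)
  show ?thesis unfolding drift_def by measurable
qed

lemma integrable_drift:
  assumes "b < M"
  shows "integrable runs (\<lambda>x. drift x S b)"
proof (rule R.integrable_const_bound)
  have "(stale (contact x S) S b + coin S b)\<^sup>2 \<le> (real b + 1)\<^sup>2" for x
    using abs_stale_le[of "contact x S" S b] abs_triangle_ineq[of "stale (contact x S) S b" "coin S b"]
    by (intro abs_le_square_iff[THEN iffD1]) simp
  then show "AE x in runs. norm (drift x S b) \<le> real l * (real l / 2 + 3) + (real b + 1)\<^sup>2 / 2"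
    by (intro AE_I2) (simp add: drift_def)
qed (use assms in measurable)

lemma integrable_fpl_sign:
  assumes "m \<le> T" "n < T"
  shows "integrable runs (\<lambda>x. fpl_sign (est x S m) (snd x (Suc n)))"
proof (rule R.integrable_const_bound[where B = 1])
  have [measurable]: "(\<lambda>x. est x S m) \<in> borel_measurable runs" "(\<lambda>x. snd x (Suc n)) \<in> borel_measurable runs"
    using assms by simp_all
  show "(\<lambda>x. fpl_sign (est x S m) (snd x (Suc n))) \<in> borel_measurable runs"
    by measurable
qed simp

text \<open>Reports up to phase \<open>n\<close> are determined by the first \<open>n\<close>
  perturbations, so redrawing the perturbation of round \<open>Suc n\<close> leaves them
  unchanged.\<close>

lemma est_upd: "m \<le> n \<Longrightarrow> est (w, r(Suc n := y)) S m = est (w, r) S m"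
  using reported_cong[of m "pay S" "pay S" "(w, r(Suc n := y))" "(w, r)" A "\<lambda>_. 0" 0]
  by (auto simp: est_def latest_cumulative_pay)

text \<open>Both reports are fixed before the perturbation of round \<open>Suc n\<close> is drawn,
  so the Lipschitz bound \<open>nn_integral_fpl_sign_diff_le\<close> applies with everything else
  frozen, and \<open>B\<close> then majorises the change of the report.\<close>

lemma integral_fpl_sign_diff_le:
  assumes "m \<le> n" "m' \<le> n" "n < T"
    and est_le: "\<And>x. \<bar>est x S m - est x S m'\<bar> \<le> B x" and "integrable runs B"
  shows "(\<integral>x. \<bar>fpl_sign (est x S m) (snd x (Suc n)) - fpl_sign (est x S m') (snd x (Suc n))\<bar> \<partial>runs)
    \<le> 2 / sqrt (real T) * (\<integral>x. B x \<partial>runs)"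
    (is "(\<integral>x. ?f x \<partial>_) \<le> _")
proof -
  have [measurable]: "(\<lambda>x. est x S m) \<in> borel_measurable runs" "(\<lambda>x. est x S m') \<in> borel_measurable runs"
    "(\<lambda>x. snd x (Suc n)) \<in> borel_measurable runs" "B \<in> borel_measurable runs"
    using assms by simp_all
  have B: "B x \<ge> 0" for x using est_le[of x] by linarith
  define g where "g x = ennreal (2 / sqrt (real T) * \<bar>est x S m - est x S m'\<bar>)" for x
  have meas: "(\<lambda>x. ennreal (?f x)) \<in> borel_measurable runs" "g \<in> borel_measurable runs"
    unfolding g_def by measurable
  have "(\<integral>\<^sup>+ x. ennreal (?f x) \<partial>runs) \<le> (\<integral>\<^sup>+ x. g x \<partial>runs)"
    unfolding run_space_def
  proof (rule nn_integral_PiM_resample_le[where t = "Suc n"])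
    fix w r
    interpret N: prob_space "fpl_noise (sqrt (real T))"
      by (rule prob_space_fpl_noise[OF sqrt_T_pos])
    show "(\<integral>\<^sup>+ y. ennreal (?f (w, r(Suc n := y))) \<partial>fpl_noise (sqrt (real T)))
        \<le> (\<integral>\<^sup>+ y. g (w, r(Suc n := y)) \<partial>fpl_noise (sqrt (real T)))"
      using nn_integral_fpl_sign_diff_le[OF sqrt_T_pos, of "est (w, r) S m" "est (w, r) S m'"] assms(1,2)
      by (simp add: g_def est_upd N.emeasure_space_1[unfolded space_fpl_noise])
  qed (use assms(3) prob_space_fpl_noise[OF sqrt_T_pos] meas[unfolded run_space_def] in auto)
  also have "\<dots> \<le> (\<integral>\<^sup>+ x. ennreal (2 / sqrt (real T) * B x) \<partial>runs)"
    unfolding g_def by (intro nn_integral_mono ennreal_leI mult_left_mono est_le) auto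
  also have "\<dots> = ennreal (\<integral>x. 2 / sqrt (real T) * B x \<partial>runs)"
    using assms(5) B by (intro nn_integral_eq_integral) auto
  finally show ?thesis
    using B assms by (subst integral_eq_nn_integral) (auto intro!: enn2real_leI simp: B)
qed

text \<open>The best expert earns at least (M l + l \<bar>walk\<bar>) / 2, and the decision of round
  \<open>Suc n\<close> earns (1 + coin * sign) / 2. The common amount M l / 2 cancels.\<close>

lemma expected_regret_pay:
  "expected_regret k T A (pay S) (\<lambda>_. 0) \<ge> real l * \<bar>walk S M\<bar> / 2 -
     (\<Sum>n<M * l. coin S (n div l) * (\<integral>x. fpl_sign (est x S n) (snd x (Suc n)) \<partial>runs)) / 2"
proof -
  have total: "(\<Sum>t=1..T. pay S t $ a t) = (\<Sum>n<M * l. pay S (Suc n) $ a (Suc n))" for a :: "nat \<Rightarrow> 2"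
  proof -
    have "(\<Sum>t=1..T. pay S t $ a t) = (\<Sum>n<T. pay S (Suc n) $ a (Suc n))"
      by (simp add: sum.atLeast1_atMost_eq)
    also have "\<dots> = (\<Sum>n<M * l. pay S (Suc n) $ a (Suc n))"
      using blocks_le by (intro sum.mono_neutral_right) (auto simp: block_payoff_def)
    finally show ?thesis .
  qed
  have action: "pay S (Suc n) $ action k A (pay S) (\<lambda>_. 0) x (Suc n) =
      (1 + coin S (n div l) * fpl_sign (est x S n) (snd x (Suc n))) / 2" if "n < M * l" for x n
    using that by (auto simp: pay_nth action_def fpl_choice_def fpl_sign_def est_def)
  then have payoff: "(\<Sum>t=1..T. pay S t $ action k A (pay S) (\<lambda>_. 0) x t) =
      (\<Sum>n<M * l. (1 + coin S (n div l) * fpl_sign (est x S n) (snd x (Suc n))) / 2)" for x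
    unfolding total by (intro sum.cong) auto
  have best: "(MAX a. \<Sum>t=1..T. pay S t $ a) \<ge> (real (M * l) + real l * \<bar>walk S M\<bar>) / 2" (is "?best \<ge> _")
  proof -
    have "(\<Sum>t=1..T. pay S t $ a) = (real (M * l) + (if a = 1 then 1 else - 1) * (real l * walk S M)) / 2" for a
      using total[of "\<lambda>_. a"] sum_blocks[of "coin S" l M]
      by (simp add: pay_nth sum.distrib walk_def flip: sum_divide_distrib sum_distrib_left sum_negf)
    note sums = this
    have "(\<Sum>t=1..T. pay S t $ a) \<le> ?best" for a
      by (intro Max_ge) auto
    from this[of 1] this[of 2] have "(real (M * l) + real l * walk S M) / 2 \<le> ?best"
      "(real (M * l) - real l * walk S M) / 2 \<le> ?best"
      unfolding sums by simp_all
    then show ?thesis by (cases "walk S M \<ge> 0") auto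
  qed
  have int: "integrable runs (\<lambda>x. fpl_sign (est x S n) (snd x (Suc n)))" if "n < M * l" for n
    using that blocks_le by (intro integrable_fpl_sign) auto
  have "expected_regret k T A (pay S) (\<lambda>_. 0) =
     (\<integral>x. ?best - (\<Sum>n<M * l. (1 + coin S (n div l) * fpl_sign (est x S n) (snd x (Suc n))) / 2) \<partial>runs)"
    unfolding expected_regret_def by (simp only: payoff)
  also have "\<dots> = ?best - (\<Sum>n<M * l. (1 + coin S (n div l) * (\<integral>x. fpl_sign (est x S n) (snd x (Suc n)) \<partial>runs)) / 2)"
  proof (subst Bochner_Integration.integral_diff)
    show "integrable runs (\<lambda>x. \<Sum>n<M * l. (1 + coin S (n div l) * fpl_sign (est x S n) (snd x (Suc n))) / 2)"
      using int by (intro Bochner_Integration.integrable_sum integrable_divide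
          Bochner_Integration.integrable_add integrable_mult_right) auto
    have "(\<integral>x. (\<Sum>n<M * l. (1 + coin S (n div l) * fpl_sign (est x S n) (snd x (Suc n))) / 2) \<partial>runs) =
        (\<Sum>n<M * l. \<integral>x. (1 + coin S (n div l) * fpl_sign (est x S n) (snd x (Suc n))) / 2 \<partial>runs)"
      using int by (intro Bochner_Integration.integral_sum integrable_divide
          Bochner_Integration.integrable_add integrable_mult_right) auto
    also have "\<dots> = (\<Sum>n<M * l. (1 + coin S (n div l) * (\<integral>x. fpl_sign (est x S n) (snd x (Suc n)) \<partial>runs)) / 2)"
      using int by (intro sum.cong refl) (simp add: R.prob_space)
    finally show "(\<integral>x. ?best \<partial>runs) -
        (\<integral>x. (\<Sum>n<M * l. (1 + coin S (n div l) * fpl_sign (est x S n) (snd x (Suc n))) / 2) \<partial>runs) =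
        ?best - (\<Sum>n<M * l. (1 + coin S (n div l) * (\<integral>x. fpl_sign (est x S n) (snd x (Suc n)) \<partial>runs)) / 2)"
      by (simp add: R.prob_space)
  qed simp
  also have "\<dots> = ?best - real (M * l) / 2 -
     (\<Sum>n<M * l. coin S (n div l) * (\<integral>x. fpl_sign (est x S n) (snd x (Suc n)) \<partial>runs)) / 2"
    by (simp add: add_divide_distrib sum.distrib sum_divide_distrib)
  finally show ?thesis using best by (simp add: add_divide_distrib)
qed

lemma integrable_contacts: "integrable runs (\<lambda>x. \<Sum>b<M. of_bool (contact x S b) :: real)"
proof (intro Bochner_Integration.integrable_sum R.integrable_const_bound[where B = 1])
  fix b assume "b \<in> {..<M}"
  then have [measurable]: "Measurable.pred runs (\<lambda>x. contact x S b)" by simp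
  show "(\<lambda>x. of_bool (contact x S b) :: real) \<in> borel_measurable runs" by measurable
qed simp

text \<open>Each block with contact contains a phase in which site 0 sends a message. Distinct
  blocks have disjoint phases, so on every run the contacts are at most the messages.\<close>

lemma expected_contacts_le:
  assumes "expected_communication k T A (pay S) (\<lambda>_. 0) \<le> ennreal B" "B \<ge> 0"
  shows "(\<integral>x. (\<Sum>b<M. of_bool (contact x S b)) \<partial>runs) \<le> B"
proof -
  have "(\<Sum>b<M. of_bool (contact x S b)) \<le>
     (\<Sum>t\<le>T. \<Sum>j<k. ups A (pay S) (\<lambda>_. 0) x t j + downs A (pay S) (\<lambda>_. 0) x t j)" (is "?N x \<le> ?K x") for x
  proof -
    have "(\<Sum>b<M. of_bool (contact x S b)) \<le> (\<Sum>b<M. \<Sum>t\<in>{b * l..<b * l + l}. of_bool (update x S (Suc t)) :: nat)"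
    proof (intro sum_mono)
      fix b
      show "of_bool (contact x S b) \<le> (\<Sum>t\<in>{b * l..<b * l + l}. of_bool (update x S (Suc t)) :: nat)"
      proof (cases "contact x S b")
        case True
        then obtain t where t: "t \<in> {b * l<..Suc b * l}" "update x S t" by (auto simp: contact_def)
        then have "t - 1 \<in> {b * l..<b * l + l}" "update x S (Suc (t - 1))" by auto
        then show ?thesis
          using True member_le_sum[of "t - 1" "{b * l..<b * l + l}" "\<lambda>t. of_bool (update x S (Suc t)) :: nat"] by simp
      qed simp
    qed
    also have "\<dots> = (\<Sum>t<M * l. of_bool (update x S (Suc t)))"
      by (rule sum.nat_group)
    also have "\<dots> \<le> (\<Sum>t<T. of_bool (update x S (Suc t)))"
      using blocks_le by (intro sum_mono2) auto
    also have "\<dots> \<le> (\<Sum>t<T. \<Sum>j<k. ups A (pay S) (\<lambda>_. 0) x (Suc t) j)"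
    proof (intro sum_mono)
      fix t
      show "of_bool (update x S (Suc t)) \<le> (\<Sum>j<k. ups A (pay S) (\<lambda>_. 0) x (Suc t) j)"
        using site member_le_sum[of 0 "{..<k}" "\<lambda>j. ups A (pay S) (\<lambda>_. 0) x (Suc t) j"] by auto
    qed
    also have "\<dots> \<le> (\<Sum>t\<le>T. \<Sum>j<k. ups A (pay S) (\<lambda>_. 0) x t j)"
      by (subst sum.atMost_shift) simp
    also have "\<dots> \<le> ?K x"
      by (intro sum_mono) simp
    finally show ?thesis .
  qed
  then have "(\<integral>\<^sup>+ x. of_nat (?N x) \<partial>runs) \<le> ennreal B"
    by (intro order_trans[OF nn_integral_mono assms(1)[unfolded expected_communication_def]])
       (simp add: of_nat_mono del: of_nat_sum)
  also have "(\<integral>\<^sup>+ x. of_nat (?N x) \<partial>runs) = (\<integral>\<^sup>+ x. ennreal (\<Sum>b<M. of_bool (contact x S b)) \<partial>runs)"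
    by (intro nn_integral_cong) (simp add: ennreal_of_nat_eq_real_of_nat)
  also have "\<dots> = ennreal (\<integral>x. (\<Sum>b<M. of_bool (contact x S b)) \<partial>runs)"
    by (intro nn_integral_eq_integral integrable_contacts) (simp add: sum_nonneg)
  finally show ?thesis
    using assms(2) by simp
qed

text \<open>The bound is proved for the average over all coin sequences in
  \<open>Pow {..<M}\<close>; some sequence reaches the average.\<close>

lemma exists_regret_ge:
  assumes "B \<ge> 0" and comm: "\<And>S. expected_communication k T A (pay S) (\<lambda>_. 0) \<le> ennreal B"
  shows "\<exists>S. expected_regret k T A (pay S) (\<lambda>_. 0) \<ge>
    real l * sqrt (3 / 2 * real M) / 6 -
      real l / sqrt (real T) * (real l * (real l / 2 + 3) * B + real M / 2)"
proof -
  define P where "P = Pow {..<M}"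
  have P: "finite P" "P \<noteq> {}" "card P = 2 ^ M"
    by (auto simp: P_def card_Pow)
  \<comment> \<open>\<open>F\<close> uses the report held at the decision, \<open>F0\<close> the one
    held at the start of the block. The latter knows nothing about the block's coin, and the
    difference of the two is paid for by \<open>drift\<close>.\<close>
  define F where "F S n = (\<integral>x. fpl_sign (est x S n) (snd x (Suc n)) \<partial>runs)" for S n
  define F0 where "F0 S n = (\<integral>x. fpl_sign (est x S (n div l * l)) (snd x (Suc n)) \<partial>runs)" for S n
  define W where "W S b = (\<integral>x. drift x S b \<partial>runs)" for S b
  define K where "K = real l * (real l / 2 + 3)"
  have less: "n div l < M" "n < T" "n div l * l \<le> n" "n \<le> Suc (n div l) * l" "n div l * l \<le> T"
    if "n < M * l" for n
    using that l_pos blocks_le order_trans[OF div_times_less_eq_dividend[of n l], of T] dividend_less_div_times[of l n]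
    by (auto simp: div_less_iff_less_mult)
  have diff: "coin S (n div l) * F S n \<le> coin S (n div l) * F0 S n + 2 / sqrt (real T) * W S (n div l)"
    if n: "n < M * l" for S n
  proof -
    have int: "integrable runs (\<lambda>x. fpl_sign (est x S n) (snd x (Suc n)))"
      "integrable runs (\<lambda>x. fpl_sign (est x S (n div l * l)) (snd x (Suc n)))"
      using less[OF n] by (auto intro!: integrable_fpl_sign)
    have "coin S (n div l) * F S n - coin S (n div l) * F0 S n \<le> \<bar>coin S (n div l) * (F S n - F0 S n)\<bar>"
      by (simp add: right_diff_distrib)
    also have "\<dots> = \<bar>\<integral>x. fpl_sign (est x S n) (snd x (Suc n)) -
        fpl_sign (est x S (n div l * l)) (snd x (Suc n)) \<partial>runs\<bar>"
      using int by (simp add: F_def F0_def abs_mult)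
    also have "\<dots> \<le> (\<integral>x. \<bar>fpl_sign (est x S n) (snd x (Suc n)) -
        fpl_sign (est x S (n div l * l)) (snd x (Suc n))\<bar> \<partial>runs)"
      by (rule integral_abs_bound)
    also have "\<dots> \<le> 2 / sqrt (real T) * W S (n div l)"
      unfolding W_def using less[OF n]
      by (intro integral_fpl_sign_diff_le est_change_le integrable_drift) auto
    finally show ?thesis by simp
  qed
  \<comment> \<open>On each run the sign in \<open>F0\<close> is determined by the coins of earlier
    blocks, so the coin sum already vanishes before integration.\<close>
  have zero: "(\<Sum>S\<in>P. coin S (n div l) * F0 S n) = 0" if n: "n < M * l" for n
  proof -
    have int: "integrable runs (\<lambda>x. fpl_sign (est x S (n div l * l)) (snd x (Suc n)))" for S
      using less[OF n] by (auto intro!: integrable_fpl_sign)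
    have "(\<Sum>S\<in>P. coin S (n div l) * fpl_sign (est x S (n div l * l)) (snd x (Suc n))) = 0" for x
      unfolding P_def using less(1)[OF n]
      by (intro sum_coin_past_determined past_determined_compose[OF past_determined_est])
    moreover have "(\<Sum>S\<in>P. coin S (n div l) * F0 S n) =
        (\<integral>x. (\<Sum>S\<in>P. coin S (n div l) * fpl_sign (est x S (n div l * l)) (snd x (Suc n))) \<partial>runs)"
      using int by (simp add: F0_def)
    ultimately show ?thesis by simp
  qed
  have drift: "(\<Sum>S\<in>P. \<Sum>b<M. W S b) \<le> 2 ^ M * (K * B + real M / 2)"
  proof -
    have "(\<Sum>S\<in>P. \<Sum>b<M. W S b) = (\<integral>x. (\<Sum>S\<in>P. \<Sum>b<M. drift x S b) \<partial>runs)"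
      unfolding W_def
      by (subst Bochner_Integration.integral_sum, (intro Bochner_Integration.integrable_sum integrable_drift; simp))
         (intro sum.cong refl Bochner_Integration.integral_sum[symmetric] integrable_drift, simp)
    also have "\<dots> \<le> (\<integral>x. K * (\<Sum>S\<in>P. \<Sum>b<M. of_bool (contact x S b)) + 2 ^ M * (real M / 2) \<partial>runs)"
      unfolding P_def K_def
      by (intro integral_mono sum_drift_le Bochner_Integration.integrable_add
          integrable_mult_right Bochner_Integration.integrable_sum integrable_drift integrable_contacts) auto
    also have "\<dots> = K * (\<Sum>S\<in>P. \<integral>x. (\<Sum>b<M. of_bool (contact x S b)) \<partial>runs) + 2 ^ M * (real M / 2)"
      using integrable_contacts by (simp add: R.prob_space del: sum_of_bool_eq)
    also have "\<dots> \<le> K * (\<Sum>S\<in>P. B) + 2 ^ M * (real M / 2)"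
      using expected_contacts_le[OF comm assms(1)]
      by (intro add_right_mono mult_left_mono sum_mono) (auto simp: K_def)
    also have "\<dots> = 2 ^ M * (K * B + real M / 2)"
      by (simp add: P algebra_simps)
    finally show ?thesis .
  qed
  have "(\<Sum>S\<in>P. \<Sum>n<M * l. coin S (n div l) * F S n) \<le>
      (\<Sum>S\<in>P. \<Sum>n<M * l. coin S (n div l) * F0 S n + 2 / sqrt (real T) * W S (n div l))"
    by (intro sum_mono diff) auto
  also have "\<dots> = (\<Sum>n<M * l. \<Sum>S\<in>P. coin S (n div l) * F0 S n) +
      2 / sqrt (real T) * (\<Sum>S\<in>P. \<Sum>n<M * l. W S (n div l))"
    by (simp add: sum.distrib sum_distrib_left sum.swap[of _ P])
  also have "\<dots> = 2 / sqrt (real T) * (real l * (\<Sum>S\<in>P. \<Sum>b<M. W S b))"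
    by (simp add: zero sum_blocks sum_distrib_left)
  also have "\<dots> \<le> 2 / sqrt (real T) * (real l * (2 ^ M * (K * B + real M / 2)))"
    by (intro mult_left_mono drift) auto
  finally have loss: "(\<Sum>S\<in>P. \<Sum>n<M * l. coin S (n div l) * F S n) \<le>
      2 / sqrt (real T) * (real l * (2 ^ M * (K * B + real M / 2)))" .
  define V where "V = real l * sqrt (3 / 2 * real M) / 6 - real l / sqrt (real T) * (K * B + real M / 2)"
  have "(\<Sum>S\<in>P. V) = real l / 2 * (2 ^ M * (sqrt (3 / 2 * real M) / 3)) -
      2 / sqrt (real T) * (real l * (2 ^ M * (K * B + real M / 2))) / 2"
    by (simp add: V_def P algebra_simps)
  also have "\<dots> \<le> real l / 2 * (\<Sum>S\<in>P. \<bar>walk S M\<bar>) -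
      (\<Sum>S\<in>P. \<Sum>n<M * l. coin S (n div l) * F S n) / 2"
    unfolding P_def
    by (intro diff_mono mult_left_mono sum_abs_walk_ge divide_right_mono loss[unfolded P_def]) auto
  also have "\<dots> = (\<Sum>S\<in>P. real l * \<bar>walk S M\<bar> / 2 - (\<Sum>n<M * l. coin S (n div l) * F S n) / 2)"
    by (simp add: sum_subtractf sum_divide_distrib sum_distrib_left)
  also have "\<dots> \<le> (\<Sum>S\<in>P. expected_regret k T A (pay S) (\<lambda>_. 0))"
    unfolding F_def by (intro sum_mono expected_regret_pay)
  finally have "\<exists>S\<in>P. V \<le> expected_regret k T A (pay S) (\<lambda>_. 0)"
    using P by (metis leI not_le sum_strict_mono)
  then show ?thesis by (auto simp: V_def K_def)
qed

end

section \<open>Choice of the block length and the contradiction\<close>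

theorem theorem5:
  fixes k :: nat and A :: "nat \<Rightarrow> 'w protocol" and \<epsilon> :: real
  assumes "k \<ge> 1"
    and "\<And>T. valid_protocol k T (A T)"
    and "\<exists>C. \<forall>\<^sub>F T in sequentially. \<forall>p s. adversary k T p s \<longrightarrow>
           expected_regret k T (A T) p s \<le> C * sqrt (real T)"
    and "\<epsilon> > 0"
  shows "\<exists>c>0. \<forall>\<^sub>F T in sequentially. \<exists>p s. adversary k T p s \<and>
           expected_communication k T (A T) p s \<ge> ennreal (c * real T powr (1 - \<epsilon>))"
proof -
  obtain C where C: "\<forall>\<^sub>F T in sequentially. \<forall>p s. adversary k T p s \<longrightarrow>
      expected_regret k T (A T) p s \<le> C * sqrt (real T)"
    using assms(3) by blast
  \<comment> \<open>With this length the gain sqrt (l T) / 8 is at least (\<bar>C\<bar> + 2) sqrt T,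
    and a loss of 3/4 sqrt T still leaves more than C sqrt T.\<close>
  obtain l :: nat where l_ge: "real l \<ge> (8 * (\<bar>C\<bar> + 2))\<^sup>2"
    using real_arch_simple by blast
  have sqrt_l: "sqrt (real l) \<ge> 8 * (\<bar>C\<bar> + 2)"
    using l_ge by (intro real_le_rsqrt)
  \<comment> \<open>From \<open>l \<ge> 6\<close> it follows that l / 2 + 3 \<le> l, so the fixed
    charge per contact in \<open>drift\<close> is at most l^2.\<close>
  have l: "l \<ge> 1" "l \<ge> 6"
    using sqrt_l real_sqrt_less_mono[of "real l" 36] by (auto simp: not_le intro!: leI)
  \<comment> \<open>With c T contacts, a charge l^2 per contact and l rounds per block, the total
    charge is at most T / 4.\<close>
  define c where "c = 1 / (4 * real l ^ 3)"
  have "c > 0" using l by (simp add: c_def)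
  have "\<forall>\<^sub>F T in sequentially. \<exists>p s. adversary k T p s \<and>
      expected_communication k T (A T) p s \<ge> ennreal (c * real T powr (1 - \<epsilon>))"
    using C eventually_ge_at_top[of "2 * l"]
  proof eventually_elim
    case (elim T)
    define M where "M = T div l"
    have "T \<ge> 1" using elim(2) l by linarith
    interpret block_run k T l M "A T"
      by standard (use assms l \<open>T \<ge> 1\<close> in \<open>auto simp: M_def\<close>)
    show ?case
    proof (rule ccontr)
      assume not: "\<not> ?thesis"
      \<comment> \<open>The budget is relaxed to c T, the order of the number of blocks, before it
        enters \<open>exists_regret_ge\<close>.\<close>
      have powr: "real T powr (1 - \<epsilon>) \<le> real T"
        using powr_mono[of "1 - \<epsilon>" 1 "real T"] \<open>T \<ge> 1\<close> \<open>\<epsilon> > 0\<close> by simp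
      have "expected_communication k T (A T) (pay S) (\<lambda>_. 0) \<le> ennreal (c * real T)" for S
      proof -
        have "expected_communication k T (A T) (pay S) (\<lambda>_. 0) \<le> ennreal (c * real T powr (1 - \<epsilon>))"
          using not adversary_pay[of S] by (meson linear)
        also have "\<dots> \<le> ennreal (c * real T)"
          using powr \<open>c > 0\<close> by (intro ennreal_leI mult_left_mono) auto
        finally show ?thesis .
      qed
      then obtain S where S: "expected_regret k T (A T) (pay S) (\<lambda>_. 0) \<ge>
          real l * sqrt (3 / 2 * real M) / 6 -
          real l / sqrt (real T) * (real l * (real l / 2 + 3) * (c * real T) + real M / 2)"
        using exists_regret_ge[of "c * real T"] \<open>c > 0\<close> by auto
      \<comment> \<open>Rounding in \<open>T div l\<close> loses fewer than \<open>l\<close> rounds,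
        at most half of them since \<open>2 * l \<le> T\<close>.\<close>
      have Ml: "real T / 2 \<le> real M * real l" "real M * real l \<le> real T"
      proof -
        have "T < M * l + l"
          using dividend_less_div_times[of l T] l by (simp add: M_def add.commute)
        then show "real T / 2 \<le> real M * real l"
          using elim(2) by (simp flip: of_nat_mult)
        show "real M * real l \<le> real T"
          using blocks_le by (simp flip: of_nat_mult)
      qed
      \<comment> \<open>Squared, the sides are l T / 64 and l^2 M / 24, and the latter is at least l
        T / 48.\<close>
      have "sqrt (real l) * sqrt (real T) / 8 \<le> real l * sqrt (3 / 2 * real M) / 6"
      proof (rule power2_le_imp_le)
        have "(sqrt (real l) * sqrt (real T) / 8)\<^sup>2 = real l * real T / 64"
          by (simp add: power_mult_distrib power_divide)
        also have "\<dots> \<le> real l * (real M * real l) / 24"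
          using mult_left_mono[of "real T / 64" "real M * real l / 24" "real l"] Ml(1) by simp
        also have "\<dots> = (real l * sqrt (3 / 2 * real M) / 6)\<^sup>2"
          by (simp add: power_mult_distrib power_divide) (simp add: power2_eq_square)
        finally show "(sqrt (real l) * sqrt (real T) / 8)\<^sup>2 \<le> (real l * sqrt (3 / 2 * real M) / 6)\<^sup>2" .
      qed simp
      \<comment> \<open>The contacts contribute 1/4 by the choice of \<open>c\<close>, the
        displacement squares 1/2 because M l \<le> T.\<close>
      moreover have "real l / sqrt (real T) * (real l * (real l / 2 + 3) * (c * real T) + real M / 2)
          \<le> 3 / 4 * sqrt (real T)"
      proof -
        have "real l * (real l * (real l / 2 + 3) * c) \<le> 1 / 4"
          using l by (simp add: c_def field_simps power3_eq_cube)
        then have "real l * (real l * (real l / 2 + 3) * c) * real T \<le> 1 / 4 * real T"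
          by (intro mult_right_mono) auto
        then have "real l * (real l * (real l / 2 + 3) * (c * real T) + real M / 2) \<le> 3 / 4 * real T"
          using Ml(2) by (simp add: algebra_simps)
        then have "real l * (real l * (real l / 2 + 3) * (c * real T) + real M / 2) / sqrt (real T)
            \<le> 3 / 4 * real T / sqrt (real T)"
          by (intro divide_right_mono) auto
        also have "\<dots> = 3 / 4 * sqrt (real T)"
          by (simp only: times_divide_eq_right[symmetric] real_div_sqrt[OF of_nat_0_le_iff])
        finally show ?thesis by simp
      qed
      ultimately have "expected_regret k T (A T) (pay S) (\<lambda>_. 0) \<ge>
          sqrt (real l) * sqrt (real T) / 8 - 3 / 4 * sqrt (real T)"
        using S by linarith
      moreover have "(8 * (\<bar>C\<bar> + 2)) * sqrt (real T) \<le> sqrt (real l) * sqrt (real T)"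
        by (intro mult_right_mono sqrt_l) auto
      ultimately have "expected_regret k T (A T) (pay S) (\<lambda>_. 0) \<ge> (\<bar>C\<bar> + 1) * sqrt (real T)"
        using sqrt_T_pos unfolding ring_distribs mult.assoc by linarith
      moreover have "(\<bar>C\<bar> + 1) * sqrt (real T) > C * sqrt (real T)"
        using sqrt_T_pos by (intro mult_strict_right_mono) auto
      ultimately show False
        using elim(1) adversary_pay[of S] by (meson not_le order_less_le_trans)
    qed
  qed
  with \<open>c > 0\<close> show ?thesis by blast
qed

end
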